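(* Let $E$ be a bounded open subset of $\mathbb{R}^n$, let $E^c=\mathbb{R}^n\setminus E$, and suppose that $\operatorname{reach}(E^c)>\rho>0$. Then for any $0<\delta<\rho$ there exists a finite partition $\mathcal{R}_E$ of $E$ such that $$|R|\ \geq\ \frac{\delta^n}{n^{n/2}}\quad\text{and}\quad \operatorname{diam}(R)\ \leq\ 3\delta\qquad\text{for all } R\in\mathcal{R}_E.$$
   Context: $|\cdot|$ applied to a set denotes $n$-dimensional Lebesgue measure. $\mathbf{U}(a,r)$ is the open ball of radius $r$ centered at $a$. For $A\subset\mathbb{R}^n$, $\operatorname{Unp}(A)$ is the set of all $x\in\mathbb{R}^n$ for which there is a unique point of $A$ nearest to $x$. For $a\in A$, $\operatorname{reach}(A,a)=\sup\{r:\mathbf{U}(a,r)\subset\operatorname{Unp}(A)\}$, and $\operatorname{reach}(A)=\inf\{\operatorname{reach}(A,a):a\in A\}$. A partition of $E$ is a family of pairwise disjoint (Lebesgue measurable) subsets of $E$ whose union is $E$. *)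

theory Defs
  imports "HOL-Analysis.Analysis"
begin

definition Unp :: "'a::metric_space set \<Rightarrow> 'a set" where
  "Unp A = {x. \<exists>!a. a \<in> A \<and> (\<forall>b\<in>A. dist x a \<le> dist x b)}"

text \<open>
  The reach takes values in the extended reals, so that it is \<open>\<infinity>\<close> for instance when every
  point has a unique nearest point. Every \<open>r \<le> 0\<close> is admissible in the supremum, since the
  ball is then empty; hence \<open>reach_at A a \<ge> 0\<close>.
\<close>

definition reach_at :: "'a::metric_space set \<Rightarrow> 'a \<Rightarrow> ereal" where
  "reach_at A a = Sup {ereal r |r. ball a r \<subseteq> Unp A}"

definition reach :: "'a::metric_space set \<Rightarrow> ereal" where
  "reach A = Inf {reach_at A a |a. a \<in> A}"

text \<open>Unlike \<^const>\<open>partition_on\<close>, this allows the empty set as a member and requires measurability.\<close>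

definition measurable_partition :: "'a::euclidean_space set \<Rightarrow> 'a set set \<Rightarrow> bool" where
  "measurable_partition E \<R> \<longleftrightarrow>
     (\<forall>R\<in>\<R>. R \<in> sets lebesgue) \<and> disjoint \<R> \<and> \<Union>\<R> = E"

end

theory Submission imports Defs begin

text \<open>
  If \<open>a\<close> is the nearest point of \<open>- E\<close> to \<open>x\<close>, the reach hypothesis lets one continue
  from \<open>a\<close> through \<open>x\<close> up to distance \<open>\<delta>\<close> with \<open>a\<close> still nearest, so some \<open>y\<close> with
  \<open>dist x y < \<delta>\<close> has \<open>ball y \<delta> \<subseteq> E\<close>. Half-open grid cubes of side \<open>\<delta> / sqrt n\<close> have all
  distances less than \<open>\<delta>\<close>, so the one containing \<open>y\<close> lies in \<open>E\<close>. Attaching every point of \<open>E\<close>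
  outside the grid cubes contained in \<open>E\<close> to one of these cubes at distance less than \<open>\<delta>\<close>
  gives sets of diameter at most \<open>\<delta> + \<delta> + \<delta>\<close>.
\<close>

section \<open>Nearest points and the distance to a closed set along normals\<close>

lemma closest_point_Unp_eqI:
  fixes A :: "'a::euclidean_space set"
  assumes "closed A" "x \<in> Unp A" "a \<in> A" "dist x a = infdist x A"
  shows "closest_point A x = a"
proof -
  have "A \<noteq> {}" using assms by auto
  have "closest_point A x \<in> A \<and> (\<forall>b\<in>A. dist x (closest_point A x) \<le> dist x b)"
    using closest_point_exists[OF assms(1) \<open>A \<noteq> {}\<close>, of x] by auto
  moreover have "a \<in> A \<and> (\<forall>b\<in>A. dist x a \<le> dist x b)"
    using assms by (auto intro: infdist_le)
  ultimately show ?thesis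
    using assms(2) unfolding Unp_def by blast
qed

lemma dist_closest_point:
  fixes A :: "'a::euclidean_space set"
  assumes "closed A" "A \<noteq> {}"
  shows "dist x (closest_point A x) = infdist x A"
proof -
  obtain a where "a \<in> A" "infdist x A = dist x a"
    using infdist_attains_inf[OF assms] .
  then show ?thesis
    using closest_point_exists[OF assms, of x] infdist_le[of "closest_point A x" A x]
    by (metis order_antisym)
qed

text \<open>A map into a compact set is continuous once its graph is closed. Uniqueness of nearest
  points makes the graph over \<open>S\<close> the set of all pairs in \<open>S \<times> A\<close>
  whose distance equals \<open>infdist\<close>, a closed condition.\<close>

lemma continuous_on_closest_point_Unp:
  fixes A S :: "'a::euclidean_space set"
  assumes "closed A" "A \<noteq> {}" "compact S" "S \<subseteq> Unp A"
  shows "continuous_on S (closest_point A)"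
proof -
  obtain b where b: "b \<in> A" using assms(2) by blast
  obtain R where R: "\<And>x. x \<in> S \<Longrightarrow> dist b x \<le> R"
    using compact_imp_bounded[OF assms(3)] unfolding bounded_any_center[where a=b] by blast
  show ?thesis
  proof (rule continuous_from_closed_graph)
    \<comment> \<open>\<open>A\<close> may be unbounded, but a nearest point of \<open>x\<close> is
      no farther from \<open>x\<close> than \<open>b\<close> is, hence within \<open>2 * R\<close>
      of \<open>b\<close>.\<close>
    show "compact (A \<inter> cball b (2 * R))"
      using assms(1) by (simp add: closed_Int_compact)
    show "closest_point A \<in> S \<rightarrow> A \<inter> cball b (2 * R)"
    proof
      fix x assume "x \<in> S"
      have "dist b (closest_point A x) \<le> dist b x + dist x (closest_point A x)"
        by (rule dist_triangle)
      also have "dist x (closest_point A x) \<le> dist b x"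
        using closest_point_le[OF assms(1) b, of x] by (simp add: dist_commute)
      finally have "dist b (closest_point A x) \<le> 2 * R"
        using R[OF \<open>x \<in> S\<close>] by simp
      then show "closest_point A x \<in> A \<inter> cball b (2 * R)"
        using closest_point_in_set[OF assms(1,2)] by simp
    qed
    have "(\<lambda>x. (x, closest_point A x)) ` S
        = (S \<times> A) \<inter> {p. dist (fst p) (snd p) = infdist (fst p) A}"
      using closest_point_in_set[OF assms(1,2)] dist_closest_point[OF assms(1,2)]
        closest_point_Unp_eqI[OF assms(1)] assms(4) by (force simp: image_iff)
    moreover have "closed \<dots>"
      using assms(1,3) by (intro closed_Int closed_Times closed_Collect_eq continuous_intros)
        (auto intro: compact_imp_closed)
    ultimately show "closed ((\<lambda>x. (x, closest_point A x)) ` S)" by simp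
  qed
qed

text \<open>Brouwer's theorem, applied to the map sending \<open>z\<close> to the point of \<open>sphere x \<epsilon>\<close> opposite
  to the nearest point of \<open>z\<close>, yields a \<open>z\<close> such that \<open>x\<close> lies between \<open>z\<close> and its nearest point.\<close>

lemma infdist_extend:
  fixes A :: "'a::euclidean_space set"
  assumes A: "closed A" "a \<in> A" and \<epsilon>: "0 < \<epsilon>" "cball x \<epsilon> \<subseteq> Unp A"
    and x: "x \<notin> A" "dist x a = infdist x A"
  shows "infdist (x + \<epsilon> *\<^sub>R sgn (x - a)) A = infdist x A + \<epsilon>"
proof -
  let ?p = "closest_point A"
  define F where "F z = x + \<epsilon> *\<^sub>R sgn (x - ?p z)" for z
  have ne: "A \<noteq> {}" using A by auto
  have p: "?p z \<in> A" for z using closest_point_in_set[OF A(1) ne] .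
  then have px: "x \<noteq> ?p z" for z using x(1) by metis
  have "continuous_on (cball x \<epsilon>) ?p"
    using continuous_on_closest_point_Unp[OF A(1) ne _ \<epsilon>(2)] by simp
  then have "continuous_on (cball x \<epsilon>) F"
    unfolding F_def sgn_div_norm using px by (intro continuous_intros) auto
  moreover have "F \<in> cball x \<epsilon> \<rightarrow> cball x \<epsilon>"
    using \<epsilon>(1) px by (auto simp: F_def dist_norm norm_sgn)
  ultimately obtain z where z: "z \<in> cball x \<epsilon>" "F z = z"
    using brouwer[of "cball x \<epsilon>" F] \<epsilon>(1) by auto
  define v where "v = sgn (x - ?p z)"
  have v: "norm v = 1" using px by (simp add: v_def norm_sgn)
  have zv: "z = x + \<epsilon> *\<^sub>R v" using z(2) by (simp add: F_def v_def)
  have "x - ?p z = dist x (?p z) *\<^sub>R v"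
    using px by (simp add: v_def sgn_div_norm dist_norm)
  moreover have "z - ?p z = (x - ?p z) + \<epsilon> *\<^sub>R v"
    using zv by (metis add_diff_eq add.commute diff_add_eq)
  ultimately have "z - ?p z = (dist x (?p z) + \<epsilon>) *\<^sub>R v"
    by (simp add: scaleR_add_left)
  then have dz: "dist z (?p z) = dist x (?p z) + \<epsilon>"
    using v \<epsilon>(1) by (simp add: dist_norm)
  \<comment> \<open>Since \<open>infdist\<close> is 1-Lipschitz, the nearest point of
    \<open>z\<close> must also be nearest to \<open>x\<close>; uniqueness at \<open>x\<close> then
    identifies it with \<open>a\<close>.\<close>
  have "infdist z A \<le> infdist x A + dist z x"
    by (rule infdist_triangle)
  also have "dist z x = \<epsilon>" using v \<epsilon>(1) by (simp add: zv dist_norm)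
  finally have "dist x (?p z) \<le> infdist x A"
    using dz dist_closest_point[OF A(1) ne, of z] by simp
  then have "dist x (?p z) = infdist x A"
    using infdist_le[OF p, of x z] by simp
  moreover have "x \<in> Unp A" using \<epsilon> by auto
  ultimately have pz: "?p z = a"
    using closest_point_Unp_eqI[OF A(1)] p A(2) x(2) by metis
  then have "infdist z A = infdist x A + \<epsilon>"
    using dz dist_closest_point[OF A(1) ne, of z] x(2) by simp
  then show ?thesis
    using z(2) by (simp add: F_def pz)
qed

text \<open>A continuation argument: the parameters in \<open>{d..t}\<close> at which
  \<open>a\<close> still realizes the distance form a compact set containing \<open>d\<close>. A
  largest one below \<open>t\<close> could be pushed on by \<open>infdist_extend\<close>.\<close>

lemma infdist_along_normal:
  fixes A :: "'a::euclidean_space set"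
  assumes A: "closed A" "a \<in> A" and r: "ball a r \<subseteq> Unp A" "t < r"
    and x: "x \<notin> A" "dist x a = infdist x A" "dist x a \<le> t"
  shows "infdist (a + t *\<^sub>R sgn (x - a)) A = t"
proof -
  define v where "v = sgn (x - a)"
  define d where "d = dist x a"
  have "x \<noteq> a" using x A by auto
  then have v: "norm v = 1" and d: "d > 0" and xv: "x = a + d *\<^sub>R v"
    by (auto simp: v_def d_def norm_sgn sgn_div_norm dist_norm)
  define T where "T = {d..t} \<inter> {s. infdist (a + s *\<^sub>R v) A = s}"
  have "closed {s. infdist (a + s *\<^sub>R v) A = s}"
    by (intro closed_Collect_eq continuous_intros)
  then have "compact T"
    unfolding T_def by (simp add: compact_Int_closed)
  moreover have "d \<in> T"
  proof -
    have "infdist (a + d *\<^sub>R v) A = d"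
      unfolding xv[symmetric] unfolding d_def using x(2) by (rule sym)
    then show ?thesis
      using x(3) unfolding T_def d_def[symmetric] by simp
  qed
  ultimately obtain s where s: "s \<in> T" and max: "\<And>u. u \<in> T \<Longrightarrow> u \<le> s"
    using compact_attains_sup[of T] by fast
  have ds: "d \<le> s" "s \<le> t" and eq: "infdist (a + s *\<^sub>R v) A = s"
    using s by (auto simp: T_def)
  have "s = t"
  proof (rule ccontr)
    assume "s \<noteq> t"
    then have st: "s < t" using ds by simp
    define y where "y = a + s *\<^sub>R v"
    have ya: "dist y a = s" using v ds d by (simp add: y_def dist_norm)
    have "y \<notin> A" using eq d ds by (auto simp: y_def)
    \<comment> \<open>Points of this ball have distance at most \<open>s + (t - s) = t < r\<close>
      from \<open>a\<close>, so the extension from \<open>y\<close> reaches \<open>t\<close>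
      itself.\<close>
    have "cball y (t - s) \<subseteq> ball a r"
    proof
      fix z assume "z \<in> cball y (t - s)"
      then show "z \<in> ball a r"
        using dist_triangle[of a z y] ya r(2) by (simp add: dist_commute)
    qed
    then have "infdist (y + (t - s) *\<^sub>R sgn (y - a)) A = infdist y A + (t - s)"
      using infdist_extend[OF A, of "t - s" y] st r(1) \<open>y \<notin> A\<close> eq ya y_def by auto
    moreover have "sgn (y - a) = v"
      using v ds d by (simp add: y_def sgn_div_norm)
    ultimately have "infdist (a + t *\<^sub>R v) A = t"
      using eq by (simp add: y_def algebra_simps)
    then have "t \<in> T" using ds by (auto simp: T_def)
    then show False using max st by force
  qed
  then show ?thesis using eq by (simp add: v_def)
qed

lemma ball_near_point_of_reach:
  fixes E :: "'a::euclidean_space set"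
  assumes "open E" "E \<noteq> UNIV" "ereal \<delta> < reach (- E)" "0 < \<delta>" "x \<in> E"
  obtains y where "ball y \<delta> \<subseteq> E" "dist x y < \<delta>"
proof -
  let ?A = "- E"
  have A: "closed ?A" "?A \<noteq> {}" using assms by auto
  obtain a where a: "a \<in> ?A" "infdist x ?A = dist x a"
    using infdist_attains_inf[OF A] .
  obtain y where y: "infdist y ?A \<ge> \<delta>" "dist x y < \<delta>"
  proof (cases "dist x a \<ge> \<delta>")
    case True
    then show ?thesis using that[of x] a assms by simp
  next
    case False
    have "reach ?A \<le> reach_at ?A a"
      unfolding reach_def using a by (intro Inf_lower) auto
    then have "ereal \<delta> < reach_at ?A a" using assms by simp
    \<comment> \<open>The strict bound on the reach leaves a radius beyond \<open>\<delta>\<close>,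
      as the motion along the normal requires.\<close>
    then obtain r where r: "\<delta> < r" "ball a r \<subseteq> Unp ?A"
      unfolding reach_at_def less_Sup_iff by auto
    let ?y = "a + \<delta> *\<^sub>R sgn (x - a)"
    have "infdist ?y ?A = \<delta>"
      using infdist_along_normal[OF A(1) a(1) r(2,1)] False a assms by auto
    \<comment> \<open>Both points lie on one ray from \<open>a\<close>, at distances
      \<open>dist x a > 0\<close> and \<open>\<delta>\<close>.\<close>
    moreover have "dist x ?y < \<delta>"
    proof -
      define v where "v = sgn (x - a)"
      have "x \<noteq> a" using a assms by auto
      then have v: "norm v = 1" "x = a + dist x a *\<^sub>R v"
        by (auto simp: v_def norm_sgn dist_norm sgn_div_norm)
      have "x - ?y = (dist x a - \<delta>) *\<^sub>R v"
        unfolding v_def[symmetric] scaleR_diff_left using v(2) by (metis add_diff_cancel_left)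
      then have "dist x ?y = \<delta> - dist x a"
        using v(1) False by (simp add: dist_norm[of x ?y])
      then show ?thesis using \<open>x \<noteq> a\<close> by simp
    qed
    ultimately show ?thesis using that[of ?y] by simp
  qed
  have "ball y \<delta> \<subseteq> E"
    using y(1) infdist_le[of _ ?A y] by fastforce
  then show ?thesis using that y by blast
qed

section \<open>Half-open grid cubes\<close>

text \<open>For \<open>s > 0\<close> this is the cube with sides
  \<open>{k * s..<(k + 1) * s}\<close> that contains \<open>x\<close>. Naming cells by a point makes
  the image of \<open>E\<close> the family of cells meeting \<open>E\<close>.\<close>

definition grid_cell :: "real \<Rightarrow> 'a::euclidean_space \<Rightarrow> 'a set" where
  "grid_cell s x = {y. \<forall>i\<in>Basis. \<lfloor>y \<bullet> i / s\<rfloor> = \<lfloor>x \<bullet> i / s\<rfloor>}"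

lemma grid_cell_self: "x \<in> grid_cell s x"
  by (simp add: grid_cell_def)

lemma disjoint_grid_cells: "disjoint (range (grid_cell s))"
  by (auto simp: disjoint_def grid_cell_def)

lemma lebesgue_grid_cell: "grid_cell s x \<in> sets lebesgue"
proof -
  have "grid_cell s x \<in> sets borel" unfolding grid_cell_def by measurable
  then show ?thesis by (intro sets_completionI_sets) simp
qed

text \<open>Equal floors keep each coordinate difference strictly below \<open>s\<close>. Strictness
  survives summation over the basis and lets a cell fit inside an open ball.\<close>

lemma dist_grid_cell_less:
  fixes x :: "'a::euclidean_space"
  assumes "0 < s" "y \<in> grid_cell s x" "z \<in> grid_cell s x"
  shows "dist y z < s * sqrt DIM('a)"
proof -
  have coord: "\<bar>(y - z) \<bullet> i\<bar> < s" if "i \<in> Basis" for i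
  proof -
    have "\<lfloor>y \<bullet> i / s\<rfloor> = \<lfloor>z \<bullet> i / s\<rfloor>"
      using assms that by (simp add: grid_cell_def)
    then have "\<bar>y \<bullet> i / s - z \<bullet> i / s\<bar> < 1" by linarith
    then have "\<bar>(y - z) \<bullet> i / s\<bar> < 1"
      by (simp add: inner_diff_left diff_divide_distrib)
    then show ?thesis using assms(1) by (simp add: abs_divide)
  qed
  then have "((y - z) \<bullet> i)\<^sup>2 < s\<^sup>2" if "i \<in> Basis" for i
    using power_strict_mono[OF coord[OF that], of 2] by simp
  then have "(\<Sum>i\<in>Basis. ((y - z) \<bullet> i)\<^sup>2) < (\<Sum>i\<in>(Basis::'a set). s\<^sup>2)"
    by (intro sum_strict_mono) auto
  moreover have "(norm (y - z))\<^sup>2 = (\<Sum>i\<in>Basis. ((y - z) \<bullet> i)\<^sup>2)"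
    unfolding power2_norm_eq_inner by (subst euclidean_inner) (simp only: power2_eq_square)
  ultimately have "(norm (y - z))\<^sup>2 < (s * sqrt DIM('a))\<^sup>2"
    by (simp add: power_mult_distrib mult.commute)
  then show ?thesis
    unfolding dist_norm by (rule power2_less_imp_less) (use assms(1) in simp)
qed

text \<open>The open interior of the cube already has the full volume, so it suffices for the lower
  bound on measures.\<close>

lemma box_subset_grid_cell:
  fixes x :: "'a::euclidean_space"
  assumes "0 < s"
  shows "\<exists>l. box l (l + s *\<^sub>R One) \<subseteq> grid_cell s x"
proof -
  define l :: 'a where "l = (\<Sum>i\<in>Basis. (s * \<lfloor>x \<bullet> i / s\<rfloor>) *\<^sub>R i)"
  have "y \<in> grid_cell s x" if "y \<in> box l (l + s *\<^sub>R One)" for y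
  proof -
    have "\<lfloor>y \<bullet> i / s\<rfloor> = \<lfloor>x \<bullet> i / s\<rfloor>" if i: "i \<in> Basis" for i
    proof -
      have "s * \<lfloor>x \<bullet> i / s\<rfloor> < y \<bullet> i" "y \<bullet> i < s * \<lfloor>x \<bullet> i / s\<rfloor> + s"
        using \<open>y \<in> _\<close> i by (auto simp: mem_box l_def inner_add_left)
      then show ?thesis
        using assms by (intro floor_unique) (auto simp: field_simps)
    qed
    then show ?thesis by (simp add: grid_cell_def)
  qed
  then show ?thesis by blast
qed

lemma finite_grid_cells_bounded:
  fixes S :: "'a::euclidean_space set"
  assumes "bounded S" "0 < s"
  shows "finite (grid_cell s ` S)"
proof -
  obtain B where B: "\<And>x. x \<in> S \<Longrightarrow> norm x \<le> B"
    using assms(1) by (auto simp: bounded_iff)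
  \<comment> \<open>Candidate vectors of floors. Extensionality outside \<open>Basis\<close> keeps
    this set finite, which is why \<open>?k\<close> is a restriction.\<close>
  let ?K = "PiE (Basis::'a set) (\<lambda>_. {\<lfloor>- B / s\<rfloor>..\<lfloor>B / s\<rfloor>})"
  have "grid_cell s ` S \<subseteq> (\<lambda>k. {y. \<forall>i\<in>Basis. \<lfloor>y \<bullet> i / s\<rfloor> = k i}) ` ?K"
  proof (rule image_subsetI)
    fix x assume "x \<in> S"
    let ?k = "restrict (\<lambda>i. \<lfloor>x \<bullet> i / s\<rfloor>) Basis"
    have "\<lfloor>x \<bullet> i / s\<rfloor> \<in> {\<lfloor>- B / s\<rfloor>..\<lfloor>B / s\<rfloor>}" if "i \<in> Basis" for i
    proof -
      have "- B \<le> x \<bullet> i" "x \<bullet> i \<le> B"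
        using Basis_le_norm[OF that, of x] B[OF \<open>x \<in> S\<close>] by linarith+
      then have "- B / s \<le> x \<bullet> i / s" "x \<bullet> i / s \<le> B / s"
        using assms(2) by (simp_all only: divide_right_mono less_imp_le)
      then show ?thesis by (simp add: floor_mono)
    qed
    then have "?k \<in> ?K" by auto
    moreover have "grid_cell s x = {y. \<forall>i\<in>Basis. \<lfloor>y \<bullet> i / s\<rfloor> = ?k i}"
      by (auto simp: grid_cell_def)
    ultimately show "grid_cell s x \<in> (\<lambda>k. {y. \<forall>i\<in>Basis. \<lfloor>y \<bullet> i / s\<rfloor> = k i}) ` ?K"
      by blast
  qed
  moreover have "finite ?K" by (intro finite_PiE) auto
  ultimately show ?thesis by (meson finite_imageI finite_subset)
qed

section \<open>Attaching the remaining points to disjoint cells\<close>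

text \<open>Each leftover point joins the first cell, in a fixed enumeration, that is closer than
  \<open>\<delta>\<close>; \<open>disjointed\<close> encodes this choice and preserves
  measurability.\<close>

lemma measurable_partition_extend:
  fixes E :: "'a::euclidean_space set" and \<Q> :: "'a set set"
  assumes \<Q>: "finite \<Q>" "disjoint \<Q>" "\<And>Q. Q \<in> \<Q> \<Longrightarrow> Q \<in> sets lebesgue" "\<Union>\<Q> \<subseteq> E"
    and E: "open E" "\<And>x. x \<in> E \<Longrightarrow> \<exists>q\<in>\<Union>\<Q>. dist x q < \<delta>"
    and diam: "\<And>Q x y. Q \<in> \<Q> \<Longrightarrow> x \<in> Q \<Longrightarrow> y \<in> Q \<Longrightarrow> dist x y \<le> \<delta>" and \<delta>: "0 < \<delta>"
  obtains \<R> where "finite \<R>" "measurable_partition E \<R>"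
    "\<And>R. R \<in> \<R> \<Longrightarrow> \<exists>Q\<in>\<Q>. Q \<subseteq> R" "\<And>R. R \<in> \<R> \<Longrightarrow> diameter R \<le> 3 * \<delta>"
proof -
  obtain Q and n :: nat where Q: "\<Q> = Q ` {0..<n}" "inj_on Q {0..<n}"
    using finite_imp_nat_seg_image_inj_on[OF \<Q>(1)] by (metis atLeast0LessThan lessThan_def)
  \<comment> \<open>A union of balls is open whatever \<open>Q k\<close> looks like. Removing all of
    \<open>\<Union>\<Q>\<close> keeps the additions disjoint from every cell.\<close>
  define N where "N k = (\<Union>q\<in>Q k. ball q \<delta>) \<inter> E - \<Union>\<Q>" for k
  define R where "R k = Q k \<union> disjointed N k" for k
  have sub: "disjointed N k \<subseteq> N k" for k by (rule disjointed_subset)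
  have N: "N k \<in> sets lebesgue" for k
  proof -
    have "(\<Union>q\<in>Q k. ball q \<delta>) \<inter> E \<in> sets lebesgue"
      using E(1) by (intro sets_completionI_sets borel_open open_Int) (auto simp: open_UN)
    moreover have "\<Union>\<Q> \<in> sets lebesgue"
      using \<Q>(1,3) by (intro sets.finite_Union) auto
    ultimately show ?thesis unfolding N_def by auto
  qed
  then have dN: "disjointed N k \<in> sets lebesgue" for k
    unfolding disjointed_def by auto
  have "\<Union>(R ` {0..<n}) = \<Union>\<Q> \<union> (\<Union>k\<in>{0..<n}. disjointed N k)"
    by (auto simp: R_def Q)
  also have "\<dots> = \<Union>\<Q> \<union> (\<Union>k\<in>{0..<n}. N k)"
    by (simp only: finite_UN_disjointed_eq)
  also have "\<dots> = E"
  proof -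
    have "x \<in> (\<Union>k\<in>{0..<n}. N k)" if x: "x \<in> E" "x \<notin> \<Union>\<Q>" for x
    proof -
      obtain k q where "k < n" "q \<in> Q k" "dist x q < \<delta>"
        using E(2)[OF x(1)] by (auto simp: Q)
      then show ?thesis
        using x by (auto simp: N_def dist_commute)
    qed
    moreover have "N k \<subseteq> E" for k by (auto simp: N_def)
    ultimately show ?thesis using \<Q>(4) by blast
  qed
  finally have union: "\<Union>(R ` {0..<n}) = E" .
  have "disjoint_family_on R {0..<n}"
    unfolding disjoint_family_on_def
  proof (intro ballI impI)
    fix i j assume ij: "i \<in> {0..<n}" "j \<in> {0..<n}" "i \<noteq> j"
    then have "Q i \<inter> Q j = {}"
      using \<Q>(2) Q by (metis disjointD imageI inj_onD)
    moreover have "disjointed N i \<inter> disjointed N j = {}"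
      using disjoint_family_disjointed[of N] ij by (simp add: disjoint_family_on_def)
    moreover have "Q i \<inter> disjointed N j = {}" "Q j \<inter> disjointed N i = {}"
      using sub[of j] sub[of i] ij by (auto simp: N_def Q)
    ultimately show "R i \<inter> R j = {}" by (auto simp: R_def)
  qed
  then have "disjoint (R ` {0..<n})"
    by (rule disjoint_family_on_disjoint_image)
  then have part: "measurable_partition E (R ` {0..<n})"
    using union dN \<Q>(3) by (auto simp: measurable_partition_def R_def Q)
  have "diameter (R k) \<le> 3 * \<delta>" if "k < n" for k
  proof (rule diameter_le)
    \<comment> \<open>A point of \<open>Q k\<close> serves as its own \<open>q\<close>, so cell
      points and attached points are treated alike.\<close>
    have near: "\<exists>q\<in>Q k. dist x q < \<delta>" if "x \<in> R k" for x
      using that sub[of k] \<delta> by (force simp: R_def N_def dist_commute)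
    fix x y assume "x \<in> R k" "y \<in> R k"
    then obtain p q where "p \<in> Q k" "dist x p < \<delta>" "q \<in> Q k" "dist y q < \<delta>"
      using near by meson
    moreover have "dist p q \<le> \<delta>"
      using diam[of "Q k" p q] calculation \<open>k < n\<close> by (simp add: Q)
    ultimately show "norm (x - y) \<le> 3 * \<delta>"
      unfolding dist_norm[symmetric]
      using dist_triangle[of x y p] dist_triangle[of p y q] by (simp add: dist_commute)
  qed (use \<delta> in simp)
  then show ?thesis
    using that[OF _ part] by (force simp: Q R_def)
qed

theorem lemma3p4:
  fixes E :: "(real ^ 'n) set" and \<rho> \<delta> :: real
  assumes "bounded E" and "open E"
    and "reach (- E) > ereal \<rho>" and "\<rho> > 0"
    and "0 < \<delta>" and "\<delta> < \<rho>"
  shows "\<exists>\<R>. finite \<R> \<and> measurable_partition E \<R> \<and>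
           (\<forall>R\<in>\<R>. measure lebesgue R \<ge> \<delta> ^ CARD('n) / real CARD('n) powr (real CARD('n) / 2)
                  \<and> diameter R \<le> 3 * \<delta>)"
proof -
  \<comment> \<open>With this side the cube has diagonal \<open>\<delta>\<close> and volume equal to
    the required lower bound.\<close>
  define s where "s = \<delta> / sqrt CARD('n)"
  have s: "s > 0" "s * sqrt CARD('n) = \<delta>" using assms by (auto simp: s_def)
  have cell: "dist y z < \<delta>" if "y \<in> grid_cell s x" "z \<in> grid_cell s x" for x y z :: "real ^ 'n"
    using dist_grid_cell_less[OF s(1) that] s(2) by simp
  define \<Q> where "\<Q> = {Q \<in> grid_cell s ` E. Q \<subseteq> E}"
  have "E \<noteq> UNIV" using assms(1) not_bounded_UNIV by blast
  have near: "\<exists>q\<in>\<Union>\<Q>. dist x q < \<delta>" if x: "x \<in> E" for x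
  proof -
    have "ereal \<delta> < reach (- E)" using assms by (metis ereal_less_eq(3) less_imp_le order_le_less_trans)
    then obtain y where y: "ball y \<delta> \<subseteq> E" "dist x y < \<delta>"
      using ball_near_point_of_reach[OF assms(2) \<open>E \<noteq> UNIV\<close> _ assms(5) x] by metis
    have "grid_cell s y \<subseteq> ball y \<delta>"
      using cell[OF grid_cell_self] by auto
    moreover have "y \<in> E" using y(1) assms(5) by auto
    ultimately have "grid_cell s y \<in> \<Q>"
      using y(1) by (auto simp: \<Q>_def)
    then show ?thesis using y(2) grid_cell_self by blast
  qed
  obtain \<R> where \<R>: "finite \<R>" "measurable_partition E \<R>"
    "\<And>R. R \<in> \<R> \<Longrightarrow> \<exists>Q\<in>\<Q>. Q \<subseteq> R" "\<And>R. R \<in> \<R> \<Longrightarrow> diameter R \<le> 3 * \<delta>"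
  proof (rule measurable_partition_extend[of \<Q> E \<delta>])
    show "finite \<Q>"
      using finite_grid_cells_bounded[OF assms(1) s(1)] by (simp add: \<Q>_def)
    show "disjoint \<Q>"
      by (rule pairwise_subset[OF disjoint_grid_cells[of s]]) (auto simp: \<Q>_def)
  qed (use near cell assms lebesgue_grid_cell in \<open>auto simp: \<Q>_def intro: less_imp_le\<close>)
  have "s ^ CARD('n) \<le> measure lebesgue R" if R: "R \<in> \<R>" for R
  proof -
    obtain x where "grid_cell s x \<subseteq> R" using \<R>(3)[OF R] by (auto simp: \<Q>_def)
    then obtain l where l: "box l (l + s *\<^sub>R One) \<subseteq> R"
      using box_subset_grid_cell[OF s(1), of x] by blast
    have "R \<subseteq> E" "R \<in> sets lebesgue"
      using \<R>(2) R by (auto simp: measurable_partition_def)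
    \<comment> \<open>\<open>measure\<close> is 0 on sets of infinite measure, so monotonicity needs
      finiteness, here from boundedness of \<open>E\<close>.\<close>
    then have "R \<in> lmeasurable"
      using assms(1) bounded_subset bounded_set_imp_lmeasurable by blast
    then have "measure lebesgue (box l (l + s *\<^sub>R One)) \<le> measure lebesgue R"
      using l by (intro measure_mono_fmeasurable) auto
    then show ?thesis
      using s(1) by (simp add: measure_completion measure_lborel_box_eq inner_add_left)
  qed
  moreover have "s ^ CARD('n) = \<delta> ^ CARD('n) / real CARD('n) powr (real CARD('n) / 2)"
  proof -
    have "sqrt CARD('n) ^ CARD('n) = sqrt CARD('n) powr real CARD('n)"
      by (rule powr_realpow[symmetric]) simp
    also have "\<dots> = real CARD('n) powr (1 / 2 * real CARD('n))"
      by (simp only: powr_half_sqrt[symmetric, OF of_nat_0_le_iff] powr_powr)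
    finally have "sqrt CARD('n) ^ CARD('n) = real CARD('n) powr (real CARD('n) / 2)"
      by simp
    then show ?thesis by (simp add: s_def power_divide)
  qed
  ultimately show ?thesis using \<R> by metis
qed

end
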